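(* Let $P$ be the real number with decimal expansion $P = 0.d_1d_2d_3\ldots$, where $d_n = \mathrm{rbln}(n^n)$ for each positive integer $n$. Then $P$ is transcendental.
   Context: For a positive integer $m$ written in base $10$, define $\mathrm{rbln}(m)$ ("right before last non-zero" digit) as follows: if $m$ has exactly one non-zero decimal digit, then $\mathrm{rbln}(m)=0$; if $m$ has at least two non-zero decimal digits, then $\mathrm{rbln}(m)$ is the decimal digit immediately to the left of the last (rightmost) non-zero digit of $m$ (this digit may itself be $0$). For example, $\mathrm{rbln}(1000)=0$ and $\mathrm{rbln}(10504200)=4$. A number is transcendental if it is not a root of any non-zero polynomial with integer coefficients. *)

theory Defs
  imports "HOL-Computational_Algebra.Polynomial"
begin

text \<open>Decimal digits are indexed from the right, starting at 0 for the units digit.\<close>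

definition dec_digit :: "nat \<Rightarrow> nat \<Rightarrow> nat"
  where "dec_digit m k = m div 10 ^ k mod 10"

definition last_nonzero_pos :: "nat \<Rightarrow> nat"
  where "last_nonzero_pos m = (LEAST k. dec_digit m k \<noteq> 0)"

text \<open>Only meaningful for positive \<open>m\<close>.\<close>

definition rbln :: "nat \<Rightarrow> nat"
  where "rbln m = (if card {k. dec_digit m k \<noteq> 0} = 1 then 0
                   else dec_digit m (Suc (last_nonzero_pos m)))"

definition rbln_const :: real
  where "rbln_const = (\<Sum>n. real (rbln (Suc n ^ Suc n)) / 10 ^ Suc n)"

lemma rbln_le_9: "rbln m \<le> 9"
proof -
  have "dec_digit m k < 10" for k
    by (simp add: dec_digit_def)
  then have "dec_digit m k \<le> 9" for k
    using less_Suc_eq_le[of "dec_digit m k" 9] by simp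
  then show ?thesis by (simp add: rbln_def)
qed

lemma rbln_const_sums: "(\<lambda>n. real (rbln (Suc n ^ Suc n)) / 10 ^ Suc n) sums rbln_const"
proof -
  have "summable (\<lambda>n. real (rbln (Suc n ^ Suc n)) / 10 ^ Suc n)"
  proof (rule summable_comparison_test')
    show "summable (\<lambda>n. (1 / 10 :: real) ^ n)"
      by (rule summable_geometric) simp
    show "norm (real (rbln (Suc n ^ Suc n)) / 10 ^ Suc n) \<le> (1 / 10) ^ n" for n
    proof -
      have "real (rbln (Suc n ^ Suc n)) \<le> 10"
        using rbln_le_9[of "Suc n ^ Suc n"] by linarith
      then have "real (rbln (Suc n ^ Suc n)) / 10 ^ Suc n \<le> 10 / 10 ^ Suc n"
        by (rule divide_right_mono) simp
      then show ?thesis by (simp add: power_one_over)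
    qed
  qed
  then show ?thesis
    unfolding rbln_const_def by (rule summable_sums)
qed

end

theory Submission
  imports Defs "HOL-Analysis.FPS_Convergence" "Jordan_Normal_Form.Determinant"
begin

text \<open>
  Write \<open>n = 10^k m\<close> with \<open>10\<close> not dividing \<open>m\<close>; the \<open>n\<close>-th digit is the tens digit of \<open>m^n\<close>. On
  indices not divisible by \<open>100\<close> the digits are periodic with period \<open>100\<close>, and \<open>e n\<close>, the digit at
  \<open>100 n\<close>, satisfies \<open>e (10 n) = e n\<close> and has period \<open>10\<close> off the multiples of \<open>10\<close>. Hence the constant
  differs by a rational number from \<open>\<xi> = f (10^(-100))\<close>, where \<open>f z = \<Sum> e n z^n\<close> is a Mahler function:
  \<open>f z - f (z^10)\<close> is a rational function with denominator \<open>1 - z^10\<close>. Consequently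
  \<open>(y - 1) (\<xi> - f (1 / y))\<close> is an integer for every \<open>y = 10^(100 * 10^k)\<close>.
  Since \<open>e 1 = 0\<close>, \<open>f (1 / y)\<close> is positive but only of size \<open>y^(-2)\<close>, so \<open>\<xi>\<close> is irrational.

  Suppose that \<open>\<xi>\<close> is algebraic of degree \<open>D\<close>. Choose a nonzero integer polynomial \<open>A (z, w)\<close> of degree
  at most \<open>D\<close> in \<open>w\<close> and \<open>M = D^2\<close> in \<open>z\<close> such that \<open>A (z, f z)\<close> vanishes at \<open>0\<close> to order
  \<open>(D + 1) (M + 1) - 1\<close>. For \<open>z = 1 / y\<close> its value is, up to a denominator of size \<open>y^(M + D)\<close>, an
  integer polynomial of degree at most \<open>D\<close> in \<open>\<xi>\<close> with coefficients of size \<open>y^(M + D)\<close>, so by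
  Liouville's inequality it cannot be that small without being \<open>0\<close>. If it is \<open>0\<close> for all large \<open>k\<close>,
  comparison with the minimal polynomial of \<open>\<xi>\<close> and \<open>z \<rightarrow> 0\<close> force \<open>\<xi>\<close> to be rational, a contradiction.
\<close>

section \<open>Liouville's inequality\<close>

text \<open>The \<open>N - 1\<close> equations are padded with a zero row to a square matrix. Its
  determinant vanishes, and over an integral domain this already gives a nonzero kernel vector with
  entries in the domain itself.\<close>

lemma underdetermined_int_system:
  fixes c :: "nat \<Rightarrow> nat \<Rightarrow> int"
  assumes "N > 0"
  shows "\<exists>x. (\<exists>j<N. x j \<noteq> 0) \<and> (\<forall>i. Suc i < N \<longrightarrow> (\<Sum>j<N. c i j * x j) = 0)"
proof -
  let ?A = "mat N N (\<lambda>(i, j). if Suc i < N then c i j else 0)"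
  have A: "?A \<in> carrier_mat N N" by simp
  have "det ?A = 0"
    unfolding det_def'[OF A]
  proof (rule sum.neutral, rule ballI)
    fix p assume "p \<in> {p. p permutes {0..<N}}"
    then have "p (N - 1) < N"
      using permutes_in_image[of p "{0..<N}" "N - 1"] assms by auto
    then have "(\<Prod>i=0..<N. ?A $$ (i, p i)) = 0"
      using assms by (intro prod_zero bexI[of _ "N - 1"]) auto
    then show "signof p * (\<Prod>i=0..<N. ?A $$ (i, p i)) = 0" by simp
  qed
  then obtain v where v: "v \<in> carrier_vec N" "v \<noteq> 0\<^sub>v N" "?A *\<^sub>v v = 0\<^sub>v N"
    using det_0_iff_vec_prod_zero[OF A] by blast
  have "\<exists>j<N. vec_index v j \<noteq> 0"
  proof (rule ccontr)
    assume "\<not> ?thesis"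
    then have "v = 0\<^sub>v N" using v(1) by (intro eq_vecI) auto
    with v(2) show False by simp
  qed
  moreover have "(\<Sum>j<N. c i j * vec_index v j) = 0" if "Suc i < N" for i
  proof -
    have "vec_index (?A *\<^sub>v v) i = (\<Sum>j<N. c i j * vec_index v j)"
      using that v(1) by (simp add: scalar_prod_def atLeast0LessThan)
    then show ?thesis using v(3) that by simp
  qed
  ultimately show ?thesis by blast
qed

text \<open>Leibniz formula with its \<open>n!\<close> products. The crude constant is harmless,
  since only the power of \<open>B\<close> enters the later comparison of exponents.\<close>

lemma abs_det_le:
  fixes A :: "int mat"
  assumes A: "A \<in> carrier_mat n n"
    and le: "\<And>i j. i < n \<Longrightarrow> j < n \<Longrightarrow> real_of_int \<bar>A $$ (i, j)\<bar> \<le> B"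
  shows "real_of_int \<bar>det A\<bar> \<le> fact n * B ^ n"
proof -
  have "real_of_int \<bar>det A\<bar> = \<bar>\<Sum>p | p permutes {0..<n}. real_of_int (signof p) * (\<Prod>i=0..<n. real_of_int (A $$ (i, p i)))\<bar>"
    by (simp add: det_def'[OF A])
  also have "\<dots> \<le> (\<Sum>p | p permutes {0..<n}. \<bar>real_of_int (signof p) * (\<Prod>i=0..<n. real_of_int (A $$ (i, p i)))\<bar>)"
    by (rule sum_abs)
  also have "\<dots> \<le> (\<Sum>p | p permutes {0..<n}. B ^ n)"
  proof (rule sum_mono)
    fix p assume "p \<in> {p. p permutes {0..<n}}"
    then have p: "p i < n" if "i < n" for i
      using permutes_in_image[of p "{0..<n}" i] that by auto
    have "\<bar>real_of_int (signof p) * (\<Prod>i=0..<n. real_of_int (A $$ (i, p i)))\<bar> = (\<Prod>i=0..<n. \<bar>real_of_int (A $$ (i, p i))\<bar>)"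
      by (simp add: abs_mult abs_prod sign_def)
    also have "\<dots> \<le> (\<Prod>i=0..<n. B)"
      using le p by (intro prod_mono) auto
    finally show "\<bar>real_of_int (signof p) * (\<Prod>i=0..<n. real_of_int (A $$ (i, p i)))\<bar> \<le> B ^ n"
      by simp
  qed
  also have "\<dots> = fact n * B ^ n"
    by (simp add: card_permutations[of "{0..<n}" n])
  finally show ?thesis .
qed

text \<open>The determinant is a nonzero integer because the rows are independent, so its absolute
  value is at least 1. On the other hand it equals \<open>g\<close> times a combination of the
  \<open>v i\<close> whose coefficients are cofactors, that is, minors of size \<open>D - 1\<close>.
  Hence \<open>B\<close> enters only to the power \<open>D - 1\<close>.\<close>

lemma int_eigenvalue_lower_bound:
  fixes M :: "nat \<Rightarrow> nat \<Rightarrow> int" and v :: "nat \<Rightarrow> real" and g B :: real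
  assumes D: "D > 0"
    and eig: "\<And>i. i < D \<Longrightarrow> (\<Sum>j<D. of_int (M i j) * v j) = g * v i"
    and v0: "v 0 = 1"
    and indep: "\<And>x :: nat \<Rightarrow> int. (\<And>j. j < D \<Longrightarrow> (\<Sum>i<D. x i * M i j) = 0) \<Longrightarrow> \<forall>i<D. x i = 0"
    and le: "\<And>i j. i < D \<Longrightarrow> j < D \<Longrightarrow> real_of_int \<bar>M i j\<bar> \<le> B"
  shows "1 \<le> \<bar>g\<bar> * (fact (D - 1) * B ^ (D - 1) * (\<Sum>i<D. \<bar>v i\<bar>))"
proof -
  let ?A = "mat D D (\<lambda>(i, j). M i j)"
  have A: "?A \<in> carrier_mat D D" by simp
  have AT: "transpose_mat ?A \<in> carrier_mat D D" by simp
  have "det ?A \<noteq> 0"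
  proof
    assume "det ?A = 0"
    then have "det (transpose_mat ?A) = 0" using det_transpose[OF A] by simp
    then obtain u where u: "u \<in> carrier_vec D" "u \<noteq> 0\<^sub>v D" "transpose_mat ?A *\<^sub>v u = 0\<^sub>v D"
      using det_0_iff_vec_prod_zero[OF AT] by blast
    have "(\<Sum>i<D. vec_index u i * M i j) = 0" if "j < D" for j
    proof -
      have "vec_index (transpose_mat ?A *\<^sub>v u) j = (\<Sum>i<D. vec_index u i * M i j)"
        using that u(1) by (simp add: scalar_prod_def atLeast0LessThan mult.commute)
      then show ?thesis using u(3) that by simp
    qed
    from indep[OF this] have "u = 0\<^sub>v D" using u(1) by (intro eq_vecI) auto
    with u(2) show False by simp
  qed
  \<comment> \<open>the first row of \<open>adj A * A = det A\<close>, applied to the eigenvector \<open>v\<close>\<close>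
  define c where "c = (\<lambda>i. cofactor ?A i 0)"
  have c: "(\<Sum>i<D. c i * M i j) = (if j = 0 then det ?A else 0)" if "j < D" for j
  proof -
    have "(adj_mat ?A * ?A) $$ (0, j) = (\<Sum>i<D. c i * M i j)"
      using that D adj_mat(1)[OF A]
      by (simp add: scalar_prod_def atLeast0LessThan c_def adj_mat_def)
    also have "(adj_mat ?A * ?A) $$ (0, j) = (if j = 0 then det ?A else 0)"
      using that D by (simp only: adj_mat(3)[OF A]) auto
    finally show ?thesis by simp
  qed
  have "g * (\<Sum>i<D. of_int (c i) * v i) = (\<Sum>i<D. of_int (c i) * (\<Sum>j<D. of_int (M i j) * v j))"
    unfolding sum_distrib_left[of g] by (intro sum.cong refl) (simp add: eig)
  also have "\<dots> = (\<Sum>j<D. (\<Sum>i<D. of_int (c i * M i j)) * v j)"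
    by (simp add: sum_distrib_left sum_distrib_right mult_ac) (rule sum.swap)
  also have "\<dots> = (\<Sum>j<D. of_int (if j = 0 then det ?A else 0) * v j)"
    by (intro sum.cong refl, simp only: c lessThan_iff flip: of_int_sum)
  also have "\<dots> = (\<Sum>j<D. if j = 0 then of_int (det ?A) else 0)"
    by (intro sum.cong) (auto simp: v0)
  also have "\<dots> = of_int (det ?A)" using D by simp
  finally have eq: "of_int (det ?A) = g * (\<Sum>i<D. of_int (c i) * v i)" by simp
  have "1 \<le> \<bar>det ?A\<bar>" using \<open>det ?A \<noteq> 0\<close> by linarith
  then have "1 \<le> \<bar>of_int (det ?A) :: real\<bar>" by linarith
  also have "\<dots> = \<bar>g\<bar> * \<bar>\<Sum>i<D. of_int (c i) * v i\<bar>"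
    by (simp add: eq abs_mult)
  also have "\<dots> \<le> \<bar>g\<bar> * (\<Sum>i<D. fact (D - 1) * B ^ (D - 1) * \<bar>v i\<bar>)"
  proof (intro mult_left_mono order.trans[OF sum_abs] sum_mono)
    fix i assume "i \<in> {..<D}"
    then have i: "i < D" by simp
    have "real_of_int \<bar>c i\<bar> = real_of_int \<bar>det (mat_delete ?A i 0)\<bar>"
      by (simp add: c_def cofactor_def abs_mult power_abs)
    also have "\<dots> \<le> fact (D - 1) * B ^ (D - 1)"
    proof (rule abs_det_le)
      show "mat_delete ?A i 0 \<in> carrier_mat (D - 1) (D - 1)"
        by (rule mat_delete_carrier) simp
      fix i' j assume "i' < D - 1" "j < D - 1"
      then show "real_of_int \<bar>mat_delete ?A i 0 $$ (i', j)\<bar> \<le> B"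
        using le by (auto simp: mat_delete_def)
    qed
    finally show "\<bar>of_int (c i) * v i\<bar> \<le> fact (D - 1) * B ^ (D - 1) * \<bar>v i\<bar>"
      by (simp add: abs_mult mult_right_mono)
  qed simp
  finally show ?thesis by (simp add: sum_distrib_left)
qed

section \<open>Integer polynomials in an algebraic number\<close>

lemma algebraic_power_reduce:
  fixes \<xi> :: real and a :: int and c :: "nat \<Rightarrow> int"
  assumes D: "D > 0" and rel: "of_int a * \<xi> ^ D = (\<Sum>j<D. of_int (c j) * \<xi> ^ j)"
  shows "\<exists>C :: nat \<Rightarrow> int. of_int (a ^ s) * \<xi> ^ s = (\<Sum>j<D. of_int (C j) * \<xi> ^ j)"
proof (induction s)
  case 0
  have "(\<Sum>j<D. of_int (if j = 0 then 1 else 0) * \<xi> ^ j) = (\<Sum>j<D. if j = 0 then 1 else 0)"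
    by (intro sum.cong) auto
  also have "\<dots> = 1" using D by simp
  finally show ?case by (intro exI[of _ "\<lambda>j. if j = 0 then 1 else 0"]) simp
next
  case (Suc s)
  then obtain C :: "nat \<Rightarrow> int" where C: "of_int (a ^ s) * \<xi> ^ s = (\<Sum>j<D. of_int (C j) * \<xi> ^ j)"
    by blast
  obtain D' where D': "D = Suc D'" using D by (cases D) auto
  \<comment> \<open>Multiplication by \<open>a * \<xi>\<close> shifts the coefficients, and the
    overflowing top term \<open>a * \<xi> ^ D\<close> is replaced by means of
    \<open>rel\<close>.\<close>
  define C' where "C' = (\<lambda>j. C D' * c j + (if j = 0 then 0 else a * C (j - 1)))"
  have "of_int (a ^ Suc s) * \<xi> ^ Suc s = of_int a * \<xi> * (\<Sum>j<D. of_int (C j) * \<xi> ^ j)"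
    by (simp flip: C)
  also have "\<dots> = (\<Sum>j<D'. of_int (a * C j) * \<xi> ^ Suc j) + of_int (C D') * (of_int a * \<xi> ^ D)"
    by (simp add: D' sum_distrib_left algebra_simps)
  also have "(\<Sum>j<D'. of_int (a * C j) * \<xi> ^ Suc j) = (\<Sum>j<D. of_int (if j = 0 then 0 else a * C (j - 1)) * \<xi> ^ j)"
    unfolding D' by (subst sum.lessThan_Suc_shift) simp
  finally show ?case
    by (intro exI[of _ C']) (simp add: rel C'_def sum_distrib_left sum.distrib algebra_simps)
qed

text \<open>After clearing denominators, multiplication by the given value is an integer matrix in
  the basis of powers of \<open>\<xi>\<close>, and the vector of these powers is an eigenvector. The
  constant \<open>\<kappa>\<close> may depend on \<open>\<xi>\<close> and \<open>n\<close>, but not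
  on \<open>g\<close> and \<open>H\<close>.\<close>

lemma algebraic_lower_bound:
  fixes \<xi> :: real and a :: int and c :: "nat \<Rightarrow> int"
  assumes D: "D > 0" and a: "a \<noteq> 0"
    and rel: "of_int a * \<xi> ^ D = (\<Sum>j<D. of_int (c j) * \<xi> ^ j)"
    and indep: "\<And>x :: nat \<Rightarrow> int. (\<Sum>j<D. of_int (x j) * \<xi> ^ j) = 0 \<Longrightarrow> \<forall>j<D. x j = 0"
  shows "\<exists>\<kappa>>0. \<forall>(g :: nat \<Rightarrow> int) H. H \<ge> 0 \<longrightarrow> (\<forall>s\<le>n. real_of_int \<bar>g s\<bar> \<le> H) \<longrightarrow>
           (\<Sum>s\<le>n. of_int (g s) * \<xi> ^ s) \<noteq> 0 \<longrightarrow>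
           \<kappa> \<le> \<bar>\<Sum>s\<le>n. of_int (g s) * \<xi> ^ s\<bar> * H ^ (D - 1)"
proof -
  obtain C0 :: "nat \<Rightarrow> nat \<Rightarrow> int"
    where C0: "\<And>s. of_int (a ^ s) * \<xi> ^ s = (\<Sum>j<D. of_int (C0 s j) * \<xi> ^ j)"
    using algebraic_power_reduce[OF D rel] by metis
  \<comment> \<open>A common denominator for all \<open>\<xi> ^ (s + i)\<close> with
    \<open>s \<le> n\<close> and \<open>i < D\<close>, the powers that occur in the multiplication
    matrix.\<close>
  define b where "b = a ^ (n + D)"
  define C where "C = (\<lambda>s j. a ^ (n + D - s) * C0 s j)"
  have C: "of_int b * \<xi> ^ s = (\<Sum>j<D. of_int (C s j) * \<xi> ^ j)" if "s \<le> n + D" for s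
  proof -
    have "of_int b * \<xi> ^ s = of_int (a ^ (n + D - s)) * (of_int (a ^ s) * \<xi> ^ s)"
      using that by (simp add: b_def flip: power_add)
    then show ?thesis by (simp only: C0 C_def) (simp add: sum_distrib_left algebra_simps)
  qed
  have b: "b \<noteq> 0" using a by (simp add: b_def)
  define K where "K = (\<Sum>s\<le>n+D. \<Sum>j<D. real_of_int \<bar>C s j\<bar>)"
  have K: "real_of_int \<bar>C s j\<bar> \<le> K" if "s \<le> n + D" "j < D" for s j
  proof -
    have "real_of_int \<bar>C s j\<bar> \<le> (\<Sum>j<D. real_of_int \<bar>C s j\<bar>)"
      using that by (intro member_le_sum[of j "{..<D}" "\<lambda>j. real_of_int \<bar>C s j\<bar>"]) auto
    also have "\<dots> \<le> K" unfolding K_def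
      using that by (intro member_le_sum[of s "{..n+D}" "\<lambda>s. \<Sum>j<D. real_of_int \<bar>C s j\<bar>"]) (auto intro: sum_nonneg)
    finally show ?thesis .
  qed
  have K0: "K \<ge> 0" unfolding K_def by (intro sum_nonneg) auto
  define L where "L = \<bar>real_of_int b\<bar> * (fact (D - 1) * (real (Suc n) * K) ^ (D - 1) * (\<Sum>i<D. \<bar>\<xi> ^ i\<bar>))"
  have L0: "L \<ge> 0" unfolding L_def by (intro mult_nonneg_nonneg sum_nonneg zero_le_power) (auto simp: K0)
  have bound: "1 \<le> (\<bar>\<Sum>s\<le>n. of_int (g s) * \<xi> ^ s\<bar> * H ^ (D - 1)) * L"
    if H: "H \<ge> 0" and g: "\<And>s. s \<le> n \<Longrightarrow> real_of_int \<bar>g s\<bar> \<le> H"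
      and nz: "(\<Sum>s\<le>n. of_int (g s) * \<xi> ^ s) \<noteq> 0" for g :: "nat \<Rightarrow> int" and H
  proof -
    define G where "G = (\<Sum>s\<le>n. of_int (g s) * \<xi> ^ s)"
    \<comment> \<open>the matrix of multiplication by \<open>b * G\<close> in the basis \<open>1, \<xi>, \<dots>, \<xi> ^ (D - 1)\<close>\<close>
    define M where "M = (\<lambda>i j. \<Sum>s\<le>n. g s * C (s + i) j)"
    have eig: "(\<Sum>j<D. of_int (M i j) * \<xi> ^ j) = (of_int b * G) * \<xi> ^ i" if "i < D" for i
    proof -
      have "(\<Sum>j<D. of_int (M i j) * \<xi> ^ j) = (\<Sum>s\<le>n. of_int (g s) * (\<Sum>j<D. of_int (C (s + i) j) * \<xi> ^ j))"
        unfolding M_def by (simp add: sum_distrib_left sum_distrib_right mult_ac) (rule sum.swap)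
      also have "\<dots> = (\<Sum>s\<le>n. of_int (g s) * (of_int b * \<xi> ^ (s + i)))"
        using that by (intro sum.cong refl) (simp add: C)
      also have "\<dots> = (of_int b * G) * \<xi> ^ i"
        by (simp add: G_def sum_distrib_left sum_distrib_right power_add mult_ac)
      finally show ?thesis .
    qed
    have "1 \<le> \<bar>of_int b * G\<bar> * (fact (D - 1) * (real (Suc n) * (H * K)) ^ (D - 1) * (\<Sum>i<D. \<bar>\<xi> ^ i\<bar>))"
    proof (rule int_eigenvalue_lower_bound[OF D eig])
      show "\<xi> ^ 0 = 1" by simp
      \<comment> \<open>A vector \<open>x\<close> annihilating the rows gives
        \<open>b * G * (\<Sum>i<D. x i * \<xi> ^ i) = 0\<close> by the eigenvector equation, so
        independence of the powers of \<open>\<xi>\<close> applies.\<close>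
      show "\<forall>i<D. x i = 0" if x: "\<And>j. j < D \<Longrightarrow> (\<Sum>i<D. x i * M i j) = 0" for x :: "nat \<Rightarrow> int"
      proof -
        have "(of_int b * G) * (\<Sum>i<D. of_int (x i) * \<xi> ^ i) = (\<Sum>i<D. of_int (x i) * (\<Sum>j<D. of_int (M i j) * \<xi> ^ j))"
          unfolding sum_distrib_left[of "of_int b * G"] by (intro sum.cong refl) (simp add: eig)
        also have "\<dots> = (\<Sum>j<D. of_int (\<Sum>i<D. x i * M i j) * \<xi> ^ j)"
          by (simp add: sum_distrib_left sum_distrib_right mult_ac) (rule sum.swap)
        also have "\<dots> = 0" by (intro sum.neutral ballI) (simp only: lessThan_iff x of_int_0 mult_zero_left)
        finally have "(\<Sum>i<D. of_int (x i) * \<xi> ^ i) = 0" using b nz by (simp add: G_def)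
        then show ?thesis by (rule indep)
      qed
      fix i j assume ij: "i < D" "j < D"
      have "real_of_int \<bar>M i j\<bar> \<le> (\<Sum>s\<le>n. \<bar>real_of_int (g s * C (s + i) j)\<bar>)"
        unfolding M_def by (simp only: of_int_abs of_int_sum) (rule sum_abs)
      also have "\<dots> \<le> (\<Sum>s\<le>n. H * K)"
      proof (rule sum_mono)
        fix s assume "s \<in> {..n}"
        then have "real_of_int \<bar>g s\<bar> * real_of_int \<bar>C (s + i) j\<bar> \<le> H * K"
          using ij H by (intro mult_mono g K) auto
        then show "\<bar>real_of_int (g s * C (s + i) j)\<bar> \<le> H * K" by (simp add: abs_mult)
      qed
      finally show "real_of_int \<bar>M i j\<bar> \<le> real (Suc n) * (H * K)" by simp
    qed
    also have "\<dots> = (\<bar>G\<bar> * H ^ (D - 1)) * L"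
      by (simp add: L_def abs_mult power_mult_distrib mult_ac)
    finally show ?thesis unfolding G_def .
  qed
  show ?thesis
  proof (intro exI[of _ "1 / (L + 1)"] conjI allI impI)
    show "0 < 1 / (L + 1)" using L0 by simp
    fix g :: "nat \<Rightarrow> int" and H :: real
    assume H: "H \<ge> 0" and g: "\<forall>s\<le>n. real_of_int \<bar>g s\<bar> \<le> H"
      and nz: "(\<Sum>s\<le>n. of_int (g s) * \<xi> ^ s) \<noteq> 0"
    let ?X = "\<bar>\<Sum>s\<le>n. of_int (g s) * \<xi> ^ s\<bar> * H ^ (D - 1)"
    have "1 \<le> ?X * L" using bound[OF H _ nz] g by blast
    moreover have "?X \<ge> 0" using H by simp
    ultimately have "1 \<le> ?X * (L + 1)" by (simp add: algebra_simps)
    then show "1 / (L + 1) \<le> ?X" using L0 by (simp add: field_simps)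
  qed
qed

text \<open>\<open>Suc D\<close> is the least number of initial powers of \<open>\<xi>\<close> that
  are dependent over the integers. By minimality the coefficient of \<open>\<xi> ^ D\<close> in a
  dependency cannot vanish; irrationality excludes \<open>D = 1\<close>.\<close>

lemma algebraic_min_relation:
  fixes \<xi> :: real
  assumes alg: "algebraic \<xi>" and irr: "\<xi> \<notin> \<rat>"
  obtains D a c where "D \<ge> 2" "a \<noteq> 0"
    "of_int a * \<xi> ^ D = (\<Sum>j<D. of_int (c j) * \<xi> ^ j)"
    "\<And>x :: nat \<Rightarrow> int. (\<Sum>j<D. of_int (x j) * \<xi> ^ j) = 0 \<Longrightarrow> \<forall>j<D. x j = 0"
proof -
  define S where "S = (\<lambda>n. \<exists>x :: nat \<Rightarrow> int. (\<exists>j<n. x j \<noteq> 0) \<and> (\<Sum>j<n. of_int (x j) * \<xi> ^ j) = 0)"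
  obtain p where p: "\<And>i. coeff p i \<in> \<int>" "p \<noteq> 0" "poly p \<xi> = 0"
    using alg unfolding algebraic_def by blast
  from p(1) have "\<forall>i. \<exists>x. coeff p i = of_int x" by (auto elim!: Ints_cases)
  then obtain x :: "nat \<Rightarrow> int" where x: "\<And>i. coeff p i = of_int (x i)" by metis
  have "S (Suc (degree p))"
    unfolding S_def
  proof (intro exI[of _ x] conjI)
    show "\<exists>j<Suc (degree p). x j \<noteq> 0"
      using p(2) x[of "degree p"] by (intro exI[of _ "degree p"]) auto
    show "(\<Sum>j<Suc (degree p). of_int (x j) * \<xi> ^ j) = 0"
      using p(3) by (simp only: poly_altdef x lessThan_Suc_atMost)
  qed
  then have "S (LEAST n. S n)" by (rule LeastI)
  moreover have least: "\<not> S n" if "n < (LEAST n. S n)" for n using that by (rule not_less_Least)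
  moreover have "\<not> S 0" by (simp add: S_def)
  ultimately obtain D where D: "(LEAST n. S n) = Suc D" "S (Suc D)"
    by (cases "LEAST n. S n") auto
  have indep: "\<forall>j<D. x j = 0" if "(\<Sum>j<D. of_int (x j) * \<xi> ^ j) = 0" for x :: "nat \<Rightarrow> int"
  proof -
    have "\<not> S D" by (rule least) (simp add: D(1))
    with that show ?thesis unfolding S_def by blast
  qed
  obtain u :: "nat \<Rightarrow> int" where u: "\<exists>j<Suc D. u j \<noteq> 0" "(\<Sum>j<Suc D. of_int (u j) * \<xi> ^ j) = 0"
    using D(2) unfolding S_def by blast
  have uD: "u D \<noteq> 0"
  proof
    assume "u D = 0"
    with u(2) have "\<forall>j<D. u j = 0" by (intro indep) simp
    with \<open>u D = 0\<close> u(1) show False by (auto simp: less_Suc_eq)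
  qed
  have rel: "of_int (u D) * \<xi> ^ D = (\<Sum>j<D. of_int (- u j) * \<xi> ^ j)"
    using u(2) by (simp add: sum_negf)
  have "D \<noteq> 0" using rel uD by (intro notI) simp
  moreover have "D \<noteq> 1"
  proof
    assume "D = 1"
    with rel have "of_int (u 1) * \<xi> = of_int (- u 0)" by simp
    then have "\<xi> = of_int (- u 0) / of_int (u 1)" using uD \<open>D = 1\<close> by (simp add: field_simps)
    with irr show False by simp
  qed
  ultimately have "D \<ge> 2" by linarith
  from that[OF this uD rel indep] show ?thesis .
qed

section \<open>Mahler's method\<close>

lemma Ints_fps_nth_power:
  fixes f :: "'a :: comm_ring_1 fps"
  assumes "\<And>n. fps_nth f n \<in> \<int>"
  shows "fps_nth (f ^ i) n \<in> \<int>"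
proof (induction i arbitrary: n)
  case (Suc i)
  then show ?case using assms by (auto simp: fps_mult_nth intro!: Ints_sum Ints_mult)
qed simp

text \<open>There are \<open>Suc D * Suc M\<close> unknown coefficients and one condition fewer. The
  unknown for \<open>z ^ l * w ^ i\<close> has index \<open>i * Suc M + l\<close>. The size of the
  solution does not matter, because the polynomials stay fixed while the evaluation point tends to
  0.\<close>

lemma auxiliary_polynomials:
  fixes f :: "real fps"
  assumes int: "\<And>n. fps_nth f n \<in> \<int>"
  obtains A :: "nat \<Rightarrow> real poly" where
    "\<And>i l. coeff (A i) l \<in> \<int>" "\<And>i. degree (A i) \<le> M" "\<exists>i\<le>D. A i \<noteq> 0"
    "\<And>n. Suc n < Suc D * Suc M \<Longrightarrow> fps_nth (\<Sum>i\<le>D. fps_of_poly (A i) * f ^ i) n = 0"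
proof -
  define N where "N = Suc D * Suc M"
  have "\<forall>n i l. \<exists>c :: int. fps_nth (fps_X ^ l * f ^ i) n = of_int c"
  proof (intro allI)
    fix n i l
    have "fps_nth (fps_X ^ l * f ^ i) n \<in> \<int>"
      using Ints_fps_nth_power[OF int] by (simp add: fps_X_power_mult_nth)
    then show "\<exists>c :: int. fps_nth (fps_X ^ l * f ^ i) n = of_int c" by (auto elim: Ints_cases)
  qed
  then obtain c :: "nat \<Rightarrow> nat \<Rightarrow> nat \<Rightarrow> int"
    where c: "\<And>n i l. fps_nth (fps_X ^ l * f ^ i) n = of_int (c n i l)" by metis
  obtain x :: "nat \<Rightarrow> int" where x: "\<exists>j<N. x j \<noteq> 0"
    "\<And>n. Suc n < N \<Longrightarrow> (\<Sum>j<N. c n (j div Suc M) (j mod Suc M) * x j) = 0"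
    using underdetermined_int_system[of N "\<lambda>n j. c n (j div Suc M) (j mod Suc M)"]
    by (auto simp: N_def)
  define A :: "nat \<Rightarrow> real poly" where "A = (\<lambda>i. \<Sum>l\<le>M. monom (of_int (x (i * Suc M + l))) l)"
  have coeff_A: "coeff (A i) l = (if l \<le> M then of_int (x (i * Suc M + l)) else 0)" for i l
    by (simp add: A_def coeff_sum)
  have "\<exists>i\<le>D. A i \<noteq> 0"
  proof -
    obtain j where j: "j < N" "x j \<noteq> 0" using x(1) by blast
    then have "j div Suc M < Suc D" by (simp add: N_def less_mult_imp_div_less)
    moreover have "coeff (A (j div Suc M)) (j mod Suc M) = of_int (x j)"
      by (simp only: coeff_A div_mult_mod_eq) (simp add: less_Suc_eq_le[symmetric] del: mult_Suc_right)
    ultimately show ?thesis using j(2)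
      by (intro exI[of _ "j div Suc M"]) (auto simp: less_Suc_eq_le)
  qed
  moreover have "fps_nth (\<Sum>i\<le>D. fps_of_poly (A i) * f ^ i) n = 0" if "Suc n < N" for n
  proof -
    have "fps_nth (\<Sum>i\<le>D. fps_of_poly (A i) * f ^ i) n
      = (\<Sum>i\<le>D. \<Sum>l\<le>M. of_int (x (i * Suc M + l)) * fps_nth (fps_X ^ l * f ^ i) n)"
      by (simp add: A_def fps_sum_nth fps_of_poly_sum fps_of_poly_monom sum_distrib_right mult.assoc del: mult_Suc_right)
    also have "\<dots> = (\<Sum>i\<le>D. \<Sum>l\<le>M. of_int (c n i l * x (i * Suc M + l)))"
      by (simp only: c) (simp add: mult.commute)
    also have "\<dots> = (\<Sum>i<Suc D. \<Sum>j=i * Suc M..<i * Suc M + Suc M. of_int (c n (j div Suc M) (j mod Suc M) * x j))"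
    proof (rule sum.cong)
      fix i
      have "(\<Sum>j=i * Suc M..<i * Suc M + Suc M. of_int (c n (j div Suc M) (j mod Suc M) * x j))
        = (\<Sum>l<Suc M. real_of_int (c n ((l + i * Suc M) div Suc M) ((l + i * Suc M) mod Suc M) * x (l + i * Suc M)))"
        using sum.shift_bounds_nat_ivl[of "\<lambda>j. real_of_int (c n (j div Suc M) (j mod Suc M) * x j)" 0 "i * Suc M" "Suc M"]
        by (simp only: atLeast0LessThan add_0 add.commute)
      also have "\<dots> = (\<Sum>l\<le>M. of_int (c n i l * x (i * Suc M + l)))"
      proof (intro sum.cong)
        fix l assume "l \<in> {..M}"
        then have "(l + i * Suc M) div Suc M = i" "(l + i * Suc M) mod Suc M = l"
          by (simp_all del: mult_Suc_right)
        then show "real_of_int (c n ((l + i * Suc M) div Suc M) ((l + i * Suc M) mod Suc M) * x (l + i * Suc M))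
          = of_int (c n i l * x (i * Suc M + l))"
          by (simp only: add.commute)
      qed auto
      finally show "(\<Sum>l\<le>M. real_of_int (c n i l * x (i * Suc M + l))) =
        (\<Sum>j=i * Suc M..<i * Suc M + Suc M. of_int (c n (j div Suc M) (j mod Suc M) * x j))" by simp
    qed auto
    also have "\<dots> = (\<Sum>j<N. of_int (c n (j div Suc M) (j mod Suc M) * x j))"
      unfolding N_def by (rule sum.nat_group)
    also have "\<dots> = 0" using x(2)[OF that] by (simp only: of_int_0 flip: of_int_sum)
    finally show ?thesis .
  qed
  moreover have "coeff (A i) l \<in> \<int>" for i l by (simp add: coeff_A)
  moreover have "degree (A i) \<le> M" for i by (rule degree_le) (simp add: coeff_A)
  ultimately show ?thesis using that N_def by blast
qed

text \<open>Factoring out \<open>z ^ m\<close> leaves a function continuous at 0, hence bounded near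
  0.\<close>

lemma has_fps_expansion_bound:
  fixes g :: "real \<Rightarrow> real"
  assumes g: "g has_fps_expansion F" and F: "\<And>n. n < m \<Longrightarrow> fps_nth F n = 0"
  shows "\<exists>C. eventually (\<lambda>z. \<bar>g z\<bar> \<le> C * \<bar>z\<bar> ^ m) (nhds 0)"
proof -
  have "F = fps_X ^ m * fps_shift m F"
    using F by (intro fps_ext) (auto simp: fps_X_power_mult_nth)
  moreover have rad: "fps_conv_radius (fps_shift m F) > 0"
    using g by (simp add: has_fps_expansion_def)
  then have *: "eval_fps (fps_shift m F) has_fps_expansion fps_shift m F"
    by (rule eval_fps_has_fps_expansion)
  ultimately have "(\<lambda>z. z ^ m * eval_fps (fps_shift m F) z) has_fps_expansion F"
    using has_fps_expansion_mult[OF has_fps_expansion_fps_X_power *] by metis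
  then have eq: "eventually (\<lambda>z. g z = z ^ m * eval_fps (fps_shift m F) z) (nhds 0)"
    using g unfolding has_fps_expansion_def by (auto elim: eventually_elim2)
  have "continuous (at 0) (eval_fps (fps_shift m F))"
    using has_fps_expansion_imp_continuous[OF *] .
  then have "((\<lambda>z. eval_fps (fps_shift m F) z) \<longlongrightarrow> eval_fps (fps_shift m F) 0) (nhds 0)"
    by (simp add: continuous_within tendsto_at_iff_tendsto_nhds)
  then have "eventually (\<lambda>z. dist (eval_fps (fps_shift m F) z) (eval_fps (fps_shift m F) 0) < 1) (nhds 0)"
    by (rule tendstoD) simp
  with eq have "eventually (\<lambda>z. \<bar>g z\<bar> \<le> (\<bar>eval_fps (fps_shift m F) 0\<bar> + 1) * \<bar>z\<bar> ^ m) (nhds 0)"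
  proof eventually_elim
    case (elim z)
    then have "\<bar>eval_fps (fps_shift m F) z\<bar> \<le> \<bar>eval_fps (fps_shift m F) 0\<bar> + 1"
      by (simp add: dist_real_def)
    then have "\<bar>z\<bar> ^ m * \<bar>eval_fps (fps_shift m F) z\<bar> \<le> \<bar>z\<bar> ^ m * (\<bar>eval_fps (fps_shift m F) 0\<bar> + 1)"
      by (intro mult_left_mono) auto
    with elim(1) show ?case by (simp add: abs_mult power_abs mult.commute)
  qed
  then show ?thesis by blast
qed

text \<open>In the limit \<open>poly p 0 = t * poly q 0\<close>. If \<open>q\<close> has a nonzero
  constant term, \<open>t\<close> is a quotient of integers; otherwise both polynomials are
  divisible by the variable, which is cancelled along \<open>z k \<noteq> 0\<close>.\<close>

lemma Rats_limit_of_poly_ratio: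
  fixes p q :: "real poly" and z \<theta> :: "nat \<Rightarrow> real"
  assumes "q \<noteq> 0" "\<And>i. coeff p i \<in> \<int>" "\<And>i. coeff q i \<in> \<int>"
    and z: "z \<longlonglongrightarrow> 0" "eventually (\<lambda>k. z k \<noteq> 0) sequentially"
    and "\<theta> \<longlonglongrightarrow> t"
    and "eventually (\<lambda>k. poly p (z k) = \<theta> k * poly q (z k)) sequentially"
  shows "t \<in> \<rat>"
  using assms(1-3,7)
proof (induction q arbitrary: p)
  case (pCons b q)
  have "(\<lambda>k. poly p (z k)) \<longlonglongrightarrow> poly p 0"
    by (intro tendsto_intros z)
  moreover have "(\<lambda>k. \<theta> k * poly (pCons b q) (z k)) \<longlonglongrightarrow> t * poly (pCons b q) 0"
    by (intro tendsto_intros z \<open>\<theta> \<longlonglongrightarrow> t\<close>)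
  then have "(\<lambda>k. poly p (z k)) \<longlonglongrightarrow> t * poly (pCons b q) 0"
    by (rule Lim_transform_eventually) (use pCons.prems(4) in \<open>auto elim: eventually_mono\<close>)
  ultimately have eq: "poly p 0 = t * b"
    using LIMSEQ_unique by (metis poly_pCons mult_zero_left add_0_right)
  show ?case
  proof (cases "b = 0")
    case False
    then have "t = coeff p 0 / b" using eq by (simp add: poly_0_coeff_0)
    moreover have "coeff p 0 \<in> \<rat>" "b \<in> \<rat>"
      using pCons.prems(2)[of 0] pCons.prems(3)[of 0] Ints_subset_Rats by auto
    ultimately show ?thesis by simp
  next
    case True
    obtain c p' where p': "p = pCons c p'" by (cases p)
    with eq True have "c = 0" by simp
    show ?thesis
    proof (rule pCons.IH)
      show "q \<noteq> 0" using pCons.prems(1) True by simp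
      show "coeff p' i \<in> \<int>" for i using pCons.prems(2)[of "Suc i"] by (simp add: p')
      show "coeff q i \<in> \<int>" for i using pCons.prems(3)[of "Suc i"] by simp
      show "eventually (\<lambda>k. poly p' (z k) = \<theta> k * poly q (z k)) sequentially"
        using pCons.prems(4) z(2) by eventually_elim (simp add: p' \<open>c = 0\<close> True)
    qed
  qed
qed simp

lemma eventually_poly_nonzero:
  fixes p :: "real poly" and z :: "nat \<Rightarrow> real"
  assumes "p \<noteq> 0" and z: "z \<longlonglongrightarrow> 0" "eventually (\<lambda>k. z k \<noteq> 0) sequentially"
  shows "eventually (\<lambda>k. poly p (z k) \<noteq> 0) sequentially"
proof -
  have "filterlim z (at 0) sequentially" using z by (simp add: filterlim_at)
  moreover have "eventually (\<lambda>x. x \<notin> {x. poly p x = 0}) (at 0)"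
    unfolding eventually_at_topological
  proof (intro exI conjI)
    show "open (- ({x. poly p x = 0} - {0}))"
      using poly_roots_finite[OF assms(1)] by (intro open_Compl finite_imp_closed finite_Diff)
  qed auto
  ultimately show ?thesis by (auto dest: eventually_compose_filterlim)
qed

section \<open>The transcendence criterion\<close>

text \<open>The hypothesis \<open>approx\<close> is all that is kept of the functional equation:
  \<open>\<xi>\<close> and the value of \<open>f\<close> at \<open>1 / y k\<close> differ by a
  rational number whose denominator is at most \<open>y k\<close>. This turns the auxiliary function
  at that point into a polynomial in \<open>\<xi>\<close> with rational coefficients.\<close>

lemma not_algebraic_if_fps_approximable:
  fixes f :: "real fps" and \<xi> :: real and y Q :: "nat \<Rightarrow> int"
  assumes int: "\<And>n. fps_nth f n \<in> \<int>" and f0: "fps_nth f 0 = 0" and rad: "fps_conv_radius f > 0"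
    and y: "filterlim (\<lambda>k. real_of_int (y k)) at_top sequentially"
    and Q: "\<And>k. 0 < Q k" "\<And>k. Q k \<le> y k"
    and approx: "\<And>k. of_int (Q k) * (\<xi> - eval_fps f (1 / of_int (y k))) \<in> \<int>"
    and irr: "\<xi> \<notin> \<rat>"
  shows "\<not> algebraic \<xi>"
proof
  assume "algebraic \<xi>"
  then obtain D a c where D: "D \<ge> 2" and a: "a \<noteq> 0"
    and rel: "of_int a * \<xi> ^ D = (\<Sum>j<D. of_int (c j) * \<xi> ^ j)"
    and indep: "\<And>x :: nat \<Rightarrow> int. (\<Sum>j<D. of_int (x j) * \<xi> ^ j) = 0 \<Longrightarrow> \<forall>j<D. x j = 0"
    using algebraic_min_relation[OF _ irr] by blast
  \<comment> \<open>Liouville's inequality costs \<open>Y ^ (M + D)\<close> once for the denominator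
    and \<open>D - 1\<close> times for the height, in total \<open>Y ^ (D * (M + D))\<close>;
    \<open>m\<close> is one more. With \<open>M = D * D\<close> the available order
    \<open>Suc D * Suc M - 1\<close> is \<open>D^3 + D^2 + D\<close>, which is at least
    \<open>m = D^3 + D^2 + 1\<close>.\<close>
  define M where "M = D * D"
  define m where "m = Suc (D * (M + D))"
  obtain A where A: "\<And>i l. coeff (A i) l \<in> \<int>" "\<And>i. degree (A i) \<le> M" "\<exists>i\<le>D. A i \<noteq> 0"
    and A0: "\<And>n. Suc n < Suc D * Suc M \<Longrightarrow> fps_nth (\<Sum>i\<le>D. fps_of_poly (A i) * f ^ i) n = 0"
    using auxiliary_polynomials[OF int, of M D] by blast
  define g where "g = (\<lambda>z. \<Sum>i\<le>D. poly (A i) z * eval_fps f z ^ i)"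
  have f_exp: "eval_fps f has_fps_expansion f" using rad by (rule eval_fps_has_fps_expansion)
  have pow_exp: "(\<lambda>z. eval_fps f z ^ i) has_fps_expansion f ^ i" for i
    by (induction i) (auto intro!: has_fps_expansion_mult f_exp)
  have "g has_fps_expansion (\<Sum>i\<le>D. fps_of_poly (A i) * f ^ i)"
    unfolding g_def
    by (intro has_fps_expansion_sum has_fps_expansion_mult pow_exp) (simp add: has_fps_expansion_def)
  moreover have "Suc n < Suc D * Suc M" if "n < m" for n
    using that D by (simp add: m_def M_def algebra_simps)
  ultimately obtain C where C: "eventually (\<lambda>z. \<bar>g z\<bar> \<le> C * \<bar>z\<bar> ^ m) (nhds 0)"
    using has_fps_expansion_bound[of g _ m] A0 by blast

  define z where "z = (\<lambda>k. 1 / real_of_int (y k))"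
  define r where "r = (\<lambda>k. \<xi> - eval_fps f (z k))"
  have y_pos: "y k > 0" for k using Q[of k] by linarith
  have z_pos: "z k > 0" for k using y_pos[of k] by (simp add: z_def)
  have z0: "z \<longlonglongrightarrow> 0"
    unfolding z_def using y by (rule tendsto_divide_0[OF tendsto_const filterlim_at_top_imp_at_infinity])
  have z_nz: "eventually (\<lambda>k. z k \<noteq> 0) sequentially"
    by (intro always_eventually allI) (use z_pos in \<open>metis less_irrefl\<close>)
  have "continuous (at 0) (eval_fps f)" using has_fps_expansion_imp_continuous[OF f_exp] .
  then have "(\<lambda>k. eval_fps f (z k)) \<longlonglongrightarrow> eval_fps f 0"
    using z0 by (rule isCont_tendsto_compose)
  then have r_lim: "r \<longlonglongrightarrow> \<xi>"
    unfolding r_def using tendsto_diff[OF tendsto_const] by (fastforce simp: eval_fps_at_0 f0)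

  \<comment> \<open>\<open>G k s\<close> is the coefficient of \<open>w ^ s\<close> in \<open>\<Sum>i. A i (z k) * (w - r k) ^ i\<close>\<close>
  define G where "G = (\<lambda>k s. \<Sum>i\<in>{s..D}. poly (A i) (z k) * (of_nat (i choose s) * (- r k) ^ (i - s)))"
  have G_poly: "(\<Sum>s\<le>D. G k s * \<xi> ^ s) = g (z k)" for k
  proof -
    have "(\<Sum>s\<le>D. G k s * \<xi> ^ s) = (\<Sum>s\<le>D. \<Sum>i\<in>{s..D}. poly (A i) (z k) * (of_nat (i choose s) * \<xi> ^ s * (- r k) ^ (i - s)))"
      by (simp add: G_def sum_distrib_right sum_distrib_left mult_ac)
    also have "\<dots> = (\<Sum>i\<le>D. \<Sum>s\<le>i. poly (A i) (z k) * (of_nat (i choose s) * \<xi> ^ s * (- r k) ^ (i - s)))"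
      by (simp add: sum.Sigma) (rule sum.reindex_bij_witness[of _ "\<lambda>(i, s). (s, i)" "\<lambda>(s, i). (i, s)"]; auto)
    also have "\<dots> = (\<Sum>i\<le>D. poly (A i) (z k) * (\<xi> + - r k) ^ i)"
      by (simp only: binomial_ring sum_distrib_left)
    finally show ?thesis by (simp add: g_def r_def)
  qed
  \<comment> \<open>The factor \<open>y k ^ M\<close> clears the denominators of
    \<open>poly (A i) (z k)\<close>, and \<open>Q k ^ D\<close> those of the powers of
    \<open>r k\<close> up to \<open>D\<close>.\<close>
  define L where "L = (\<lambda>k. real_of_int (y k) ^ M * of_int (Q k) ^ D)"
  have L_pos: "L k > 0" for k using y_pos[of k] Q(1)[of k] by (simp add: L_def)
  have L_le: "L k \<le> real_of_int (y k) ^ (M + D)" for k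
    unfolding L_def power_add using Q[of k] y_pos[of k]
    by (intro mult_left_mono power_mono) auto
  have G_int: "L k * G k s \<in> \<int>" for k s
  proof -
    have *: "of_int (y k) ^ M * poly (A i) (z k) \<in> \<int>" for i
    proof -
      have poly_eq: "poly (A i) (z k) = (\<Sum>l\<le>M. coeff (A i) l * z k ^ l)"
        unfolding poly_altdef using A(2)[of i]
        by (intro sum.mono_neutral_left) (auto simp: coeff_eq_0)
      have "of_int (y k) ^ M * poly (A i) (z k) = (\<Sum>l\<le>M. coeff (A i) l * of_int (y k) ^ (M - l))"
        unfolding poly_eq sum_distrib_left
      proof (intro sum.cong refl)
        fix l assume "l \<in> {..M}"
        then have "real_of_int (y k) ^ M = of_int (y k) ^ (M - l) * of_int (y k) ^ l"
          by (simp flip: power_add)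
        then show "of_int (y k) ^ M * (coeff (A i) l * z k ^ l) = coeff (A i) l * of_int (y k) ^ (M - l)"
          using y_pos[of k] by (simp add: z_def power_divide)
      qed
      then show ?thesis using A(1) by (auto intro!: Ints_sum Ints_mult Ints_power)
    qed
    have "L k * G k s = (\<Sum>i\<in>{s..D}. (of_int (y k) ^ M * poly (A i) (z k)) *
      (of_nat (i choose s) * of_int (Q k) ^ (D - (i - s)) * (- (of_int (Q k) * r k)) ^ (i - s)))"
      unfolding G_def sum_distrib_left
    proof (intro sum.cong refl)
      fix i assume "i \<in> {s..D}"
      then have "real_of_int (Q k) ^ D = of_int (Q k) ^ (D - (i - s)) * of_int (Q k) ^ (i - s)"
        by (simp flip: power_add)
      moreover have "(- (of_int (Q k) * r k)) ^ (i - s) = of_int (Q k) ^ (i - s) * (- r k) ^ (i - s)"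
        by (simp flip: power_mult_distrib)
      ultimately show "L k * (poly (A i) (z k) * (of_nat (i choose s) * (- r k) ^ (i - s))) =
        (of_int (y k) ^ M * poly (A i) (z k)) *
        (of_nat (i choose s) * of_int (Q k) ^ (D - (i - s)) * (- (of_int (Q k) * r k)) ^ (i - s))"
        by (simp add: L_def mult_ac)
    qed
    also have "\<dots> \<in> \<int>"
    proof (rule Ints_sum)
      fix i
      have "of_int (Q k) * r k \<in> \<int>" using approx[of k] by (simp add: r_def z_def)
      then obtain w where w: "of_int (Q k) * r k = of_int w" by (elim Ints_cases)
      have "of_nat (i choose s) * of_int (Q k) ^ (D - (i - s)) * (- (of_int (Q k) * r k)) ^ (i - s) \<in> \<int>"
        unfolding w by (intro Ints_mult Ints_power Ints_minus) auto
      with * show "(of_int (y k) ^ M * poly (A i) (z k)) *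
        (of_nat (i choose s) * of_int (Q k) ^ (D - (i - s)) * (- (of_int (Q k) * r k)) ^ (i - s)) \<in> \<int>"
        by (rule Ints_mult)
    qed
    finally show ?thesis .
  qed
  then have "\<forall>k s. \<exists>x :: int. L k * G k s = of_int x" by (auto elim!: Ints_cases)
  then obtain h :: "nat \<Rightarrow> nat \<Rightarrow> int" where h: "\<And>k s. of_int (h k s) = L k * G k s" by metis
  have h_sum: "(\<Sum>s\<le>D. of_int (h k s) * \<xi> ^ s) = L k * g (z k)" for k
    by (simp add: h sum_distrib_left mult.assoc flip: G_poly)

  \<comment> \<open>Each \<open>G k s\<close> converges as \<open>k\<close> grows, since
    \<open>z k\<close> tends to 0 and \<open>r k\<close> to \<open>\<xi>\<close>; so it is bounded
    uniformly in \<open>k\<close>.\<close>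
  have "\<exists>B>0. \<forall>k. \<bar>G k s\<bar> \<le> B" for s
  proof -
    have "(\<lambda>k. G k s) \<longlonglongrightarrow> (\<Sum>i\<in>{s..D}. poly (A i) 0 * (of_nat (i choose s) * (- \<xi>) ^ (i - s)))"
      unfolding G_def by (intro tendsto_intros z0 r_lim)
    then have "Bseq (\<lambda>k. G k s)" by (intro convergent_imp_Bseq) (auto simp: convergent_def)
    then show ?thesis by (auto simp: Bseq_def)
  qed
  then obtain B0 where B0: "\<And>s. B0 s > 0" "\<And>k s. \<bar>G k s\<bar> \<le> B0 s" by metis
  define B where "B = (\<Sum>s\<le>D. B0 s)"
  have B_nn: "B \<ge> 0" unfolding B_def using B0(1) by (intro sum_nonneg) (auto intro: less_imp_le)
  have B: "\<bar>G k s\<bar> \<le> B" if "s \<le> D" for k s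
    using B0(2)[of k s] member_le_sum[of s "{..D}" B0] B0(1) that
    by (force simp: B_def less_imp_le)
  have h_le: "real_of_int \<bar>h k s\<bar> \<le> B * of_int (y k) ^ (M + D)" if "s \<le> D" for k s
  proof -
    have "real_of_int \<bar>h k s\<bar> = \<bar>G k s\<bar> * L k" using L_pos[of k] by (simp add: h abs_mult)
    also have "\<dots> \<le> B * of_int (y k) ^ (M + D)"
      using B[OF that] L_le L_pos[of k] B_nn by (intro mult_mono) (auto simp: less_imp_le)
    finally show ?thesis .
  qed

  have "D > 0" using D by simp
  from algebraic_lower_bound[OF this a rel indep, of D]
  obtain \<kappa> where \<kappa>: "\<kappa> > 0" and lower: "\<And>(g :: nat \<Rightarrow> int) H. H \<ge> 0 \<Longrightarrow> (\<forall>s\<le>D. real_of_int \<bar>g s\<bar> \<le> H) \<Longrightarrow>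
           (\<Sum>s\<le>D. of_int (g s) * \<xi> ^ s) \<noteq> 0 \<Longrightarrow>
           \<kappa> \<le> \<bar>\<Sum>s\<le>D. of_int (g s) * \<xi> ^ s\<bar> * H ^ (D - 1)"
    by blast
  have vanish: "eventually (\<lambda>k. g (z k) = 0) sequentially"
  proof -
    \<comment> \<open>This is what remains of the upper bound after all powers of \<open>y k\<close>
      but one have cancelled.\<close>
    have "(\<lambda>k. C * B ^ (D - 1) * z k) \<longlonglongrightarrow> C * B ^ (D - 1) * 0"
      by (intro tendsto_intros z0)
    then have "eventually (\<lambda>k. C * B ^ (D - 1) * z k < \<kappa>) sequentially"
      using \<kappa> by (intro order_tendstoD) auto
    moreover have "eventually (\<lambda>k. \<bar>g (z k)\<bar> \<le> C * \<bar>z k\<bar> ^ m) sequentially"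
      using z0 C by (rule eventually_compose_filterlim[rotated])
    ultimately show ?thesis
    proof eventually_elim
      case (elim k)
      show "g (z k) = 0"
      proof (rule ccontr)
        assume nz: "g (z k) \<noteq> 0"
        define Y where "Y = real_of_int (y k)"
        have Y: "Y > 0" "z k = 1 / Y" using y_pos[of k] by (simp_all add: Y_def z_def)
        have "\<kappa> \<le> \<bar>L k * g (z k)\<bar> * (B * Y ^ (M + D)) ^ (D - 1)"
          using lower[of "B * Y ^ (M + D)" "h k"] h_le[of _ k] nz L_pos[of k] B_nn Y
          by (simp add: h_sum Y_def)
        also have "\<dots> \<le> (Y ^ (M + D) * (C * z k ^ m)) * (B * Y ^ (M + D)) ^ (D - 1)"
          using L_le[of k] L_pos[of k] elim(2) z_pos[of k] B_nn Y
          by (intro mult_right_mono) (auto simp: abs_mult Y_def intro!: mult_mono)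
        also have "\<dots> = C * B ^ (D - 1) * (Y ^ (M + D) * (Y ^ (M + D)) ^ (D - 1)) * z k ^ m"
          by (simp add: power_mult_distrib mult_ac)
        also have "Y ^ (M + D) * (Y ^ (M + D)) ^ (D - 1) = Y ^ (D * (M + D))"
          using \<open>D > 0\<close> by (cases D) (simp_all flip: power_mult power_add add: mult.commute algebra_simps)
        also have "C * B ^ (D - 1) * Y ^ (D * (M + D)) * z k ^ m = C * B ^ (D - 1) * z k"
          using Y(1) by (simp add: m_def Y(2) power_divide)
        finally show False using elim(1) by simp
      qed
    qed
  qed

  \<comment> \<open>The \<open>h k s\<close> are now the coefficients of a relation of degree at
    most \<open>D\<close>. Eliminating \<open>\<xi> ^ D\<close> with the minimal relation leaves
    degree below \<open>D\<close>, so all coefficients vanish by \<open>indep\<close>.\<close>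
  have coeff_rel: "eventually (\<lambda>k. \<forall>s<D. of_int a * G k s = - of_int (c s) * G k D) sequentially"
    using vanish
  proof eventually_elim
    case (elim k)
    have "(\<Sum>s<D. of_int (a * h k s + h k D * c s) * \<xi> ^ s)
      = of_int a * (\<Sum>s<D. of_int (h k s) * \<xi> ^ s) + of_int (h k D) * (\<Sum>j<D. of_int (c j) * \<xi> ^ j)"
      by (simp add: sum_distrib_left sum.distrib algebra_simps)
    also have "\<dots> = of_int a * (\<Sum>s\<le>D. of_int (h k s) * \<xi> ^ s)"
      by (simp add: algebra_simps flip: rel lessThan_Suc_atMost)
    also have "\<dots> = 0" by (simp add: h_sum elim)
    finally have *: "\<forall>s<D. a * h k s + h k D * c s = 0" by (rule indep)
    show ?case
    proof (intro allI impI)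
      fix s assume "s < D"
      with * have "real_of_int (a * h k s + h k D * c s) = 0" by simp
      then have "L k * (of_int a * G k s + of_int (c s) * G k D) = 0"
        by (simp add: h algebra_simps)
      then show "of_int a * G k s = - of_int (c s) * G k D" using L_pos[of k] by simp
    qed
  qed
  have GD: "G k D = poly (A D) (z k)" for k by (simp add: G_def)
  \<comment> \<open>The top two coefficients of \<open>G k\<close> and of the minimal polynomial are proportional; for \<open>A D \<noteq> 0\<close> this
    expresses \<open>D * r k\<close>, up to a rational constant, as a rational function of \<open>z k\<close>.\<close>
  show False
  proof (cases "A D = 0")
    case True
    \<comment> \<open>For the largest \<open>i\<close> with \<open>A i \<noteq> 0\<close> only one
      term survives in \<open>G k i\<close>, while \<open>G k D = 0\<close> forces
      \<open>G k i = 0\<close>. So \<open>A i\<close> would vanish at \<open>z k\<close> for all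
      large \<open>k\<close>.\<close>
    define i where "i = Max {i. i \<le> D \<and> A i \<noteq> 0}"
    have fin: "finite {i. i \<le> D \<and> A i \<noteq> 0}" by simp
    have i: "i \<le> D" "A i \<noteq> 0" using Max_in[OF fin] A(3) by (auto simp: i_def)
    then have "i < D" using True by (cases "i = D") auto
    have above: "A j = 0" if "i < j" "j \<le> D" for j
    proof (rule ccontr)
      assume "A j \<noteq> 0"
      with that have "j \<le> i" unfolding i_def by (intro Max_ge fin) simp
      with that show False by simp
    qed
    have Gi: "G k i = poly (A i) (z k)" for k
    proof -
      have "G k i = (\<Sum>j\<in>{i}. poly (A j) (z k) * (of_nat (j choose i) * (- r k) ^ (j - i)))"
        unfolding G_def using above i(1) by (intro sum.mono_neutral_right) auto
      then show ?thesis by simp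
    qed
    have "eventually (\<lambda>k. poly (A i) (z k) \<noteq> 0) sequentially"
      using i(2) z0 z_nz by (rule eventually_poly_nonzero)
    with coeff_rel have "eventually (\<lambda>k :: nat. False) sequentially"
      by eventually_elim (use \<open>i < D\<close> a in \<open>auto simp: GD True Gi\<close>)
    then show False by simp
  next
    case False
    define E where "E = D - 1"
    have E: "D = Suc E" using D by (simp add: E_def)
    have GE: "G k E = poly (A E) (z k) - real D * r k * poly (A D) (z k)" for k
    proof -
      have "{E..D} = {E, D}" by (auto simp: E)
      then show ?thesis by (simp add: G_def E algebra_simps)
    qed
    \<comment> \<open>This limit is shown to be rational, which makes \<open>\<xi>\<close>
      rational.\<close>
    have "(\<lambda>k. real D * r k - of_int (c E) / of_int a) \<longlonglongrightarrow> real D * \<xi> - of_int (c E) / of_int a"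
      by (intro tendsto_intros r_lim)
    moreover have "eventually (\<lambda>k. poly (A E) (z k) = (real D * r k - of_int (c E) / of_int a) * poly (A D) (z k)) sequentially"
      using coeff_rel
    proof eventually_elim
      case (elim k)
      then have "of_int a * G k E = - of_int (c E) * G k D" by (simp add: E)
      then have "G k E = - of_int (c E) / of_int a * G k D" using a by (simp add: field_simps)
      then show ?case by (simp add: GE GD algebra_simps)
    qed
    ultimately have "real D * \<xi> - of_int (c E) / of_int a \<in> \<rat>"
      using Rats_limit_of_poly_ratio[OF False A(1) A(1) z0 z_nz] by blast
    then have "(real D * \<xi> - of_int (c E) / of_int a) + of_int (c E) / of_int a \<in> \<rat>" by (intro Rats_add) auto
    then have "real D * \<xi> / real D \<in> \<rat>" by (intro Rats_divide) auto
    with irr \<open>D > 0\<close> show False by simp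
  qed
qed

section \<open>The digits of powers\<close>

lemma rbln_eq:
  assumes u: "u mod 10 \<noteq> 0"
  shows "rbln (10 ^ t * u) = u mod 100 div 10"
proof -
  let ?m = "10 ^ t * u"
  have below: "dec_digit ?m k = 0" if "k < t" for k
  proof -
    have "(10::nat) ^ t = 10 ^ k * (10 * 10 ^ (t - k - 1))"
      using that by (simp flip: power_add power_Suc)
    then have "?m = 10 ^ k * (10 * (10 ^ (t - k - 1) * u))" by simp
    then have "?m div 10 ^ k = 10 * (10 ^ (t - k - 1) * u)"
      by (metis nonzero_mult_div_cancel_left power_not_zero zero_neq_numeral)
    then show ?thesis by (simp add: dec_digit_def)
  qed
  have at: "dec_digit ?m t = u mod 10" by (simp add: dec_digit_def)
  have next_digit: "dec_digit ?m (Suc t) = u mod 100 div 10"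
  proof -
    have "?m div 10 ^ Suc t = u div 10" by (simp add: power_Suc2 div_mult2_eq del: power_Suc)
    moreover have "u div 10 mod 10 = u mod 100 div 10" using mod_mult2_eq[of u 10 10] by simp
    ultimately show ?thesis by (simp add: dec_digit_def)
  qed
  have "last_nonzero_pos ?m = t"
    unfolding last_nonzero_pos_def
    by (rule Least_equality) (use at u below in \<open>auto intro: leI\<close>)
  \<comment> \<open>In the special case of the definition the value 0 agrees with the general
    formula, because a second nonzero digit is excluded.\<close>
  moreover have "dec_digit ?m (Suc t) = 0" if one: "card {k. dec_digit ?m k \<noteq> 0} = 1"
  proof (rule ccontr)
    assume "dec_digit ?m (Suc t) \<noteq> 0"
    moreover obtain k where "{k. dec_digit ?m k \<noteq> 0} = {k}"
      using one by (auto simp: card_1_singleton_iff)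
    ultimately show False using at u by (metis (mono_tags) mem_Collect_eq n_not_Suc_n singletonD)
  qed
  ultimately show ?thesis by (auto simp: rbln_def next_digit)
qed

abbreviation digit :: "nat \<Rightarrow> nat" where "digit n \<equiv> rbln (n ^ n)"

lemma mod_10_power_nonzero:
  fixes m :: nat
  assumes "m mod 10 \<noteq> 0"
  shows "m ^ e mod 10 \<noteq> 0"
proof
  assume "m ^ e mod 10 = 0"
  then have "2 dvd m ^ e" "5 dvd m ^ e" by presburger+
  then have "2 dvd m" "5 dvd m"
    by (auto dest: prime_dvd_power[rotated])
  with assms show False by presburger
qed

lemma digit_eq:
  assumes "m mod 10 \<noteq> 0" "n = 10 ^ k * m"
  shows "digit n = m ^ n mod 100 div 10"
proof -
  have "n ^ n = (10 ^ k * m) ^ n" by (simp only: flip: assms(2))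
  also have "\<dots> = 10 ^ (k * n) * m ^ n" by (simp add: power_mult_distrib power_mult)
  finally have "n ^ n = 10 ^ (k * n) * m ^ n" .
  then show ?thesis using rbln_eq[OF mod_10_power_nonzero[OF assms(1)]] by simp
qed

section \<open>Powers modulo 100\<close>

text \<open>Binomial theorem: all terms beyond the linear one contain \<open>10 ^ 2\<close>. For
  exponent 10 the linear term drops out as well.\<close>

lemma add_10_power_mod_100: "((x::nat) + 10) ^ Suc n mod 100 = (x ^ Suc n + 10 * Suc n * x ^ n) mod 100"
proof (induction n)
  case (Suc n)
  have "(x + 10) ^ Suc (Suc n) mod 100 = (x + 10) * ((x + 10) ^ Suc n mod 100) mod 100"
    by (simp only: power_Suc[of _ "Suc n"] mod_mult_right_eq)
  also have "\<dots> = (x + 10) * (x ^ Suc n + 10 * Suc n * x ^ n) mod 100"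
    by (simp only: Suc.IH mod_mult_right_eq)
  also have "(x + 10) * (x ^ Suc n + 10 * Suc n * x ^ n)
    = (x ^ Suc (Suc n) + 10 * Suc (Suc n) * x ^ Suc n) + 100 * (Suc n * x ^ n)"
    by (simp add: algebra_simps)
  finally show ?case by (simp only: mod_mult_self2)
qed simp

lemma add_10_power_10_mod_100: "((x::nat) + 10) ^ 10 mod 100 = x ^ 10 mod 100"
  using add_10_power_mod_100[of x 9] by simp

lemma power_20_mod_100: "(x::nat) ^ 20 mod 100 = (x mod 10) ^ 20 mod 100"
proof -
  have *: "(b + 10 * q) ^ 10 mod 100 = b ^ 10 mod 100" for b q :: nat
  proof (induction q)
    case (Suc q)
    then show ?case using add_10_power_10_mod_100[of "b + 10 * q"] by (simp add: algebra_simps)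
  qed simp
  have "x ^ 10 mod 100 = (x mod 10) ^ 10 mod 100"
    using *[of "x mod 10" "x div 10"] by simp
  then have "(x ^ 10) ^ 2 mod 100 = ((x mod 10) ^ 10) ^ 2 mod 100"
    by (metis power_mod)
  then show ?thesis by (simp flip: power_mult)
qed

text \<open>Depending on the last digit of \<open>x\<close>, the residue of \<open>x ^ 20\<close> is
  1, 76, 25 or 0. Multiplication by it fixes \<open>x ^ 2\<close>, which is divisible by 4, 25 or
  100 in the last three cases.\<close>

lemma power_22_mod_100: "(x::nat) ^ 22 mod 100 = x ^ 2 mod 100"
proof -
  have "x ^ 22 = x ^ 20 * x ^ 2" by (simp flip: power_add)
  then have eq: "x ^ 22 mod 100 = ((x mod 10) ^ 20 mod 100) * x ^ 2 mod 100"
    by (metis mod_mult_left_eq power_20_mod_100)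
  have "x mod 10 \<in> {1, 3, 7, 9} \<or> x mod 10 \<in> {2, 4, 6, 8} \<or> x mod 10 = 5 \<or> x mod 10 = 0"
    by (simp, presburger)
  then consider "x mod 10 \<in> {1, 3, 7, 9}" | "x mod 10 \<in> {2, 4, 6, 8}" | "x mod 10 = 5" | "x mod 10 = 0"
    by metis
  then show ?thesis
  proof cases
    case 1
    then have "(x mod 10) ^ 20 mod 100 = 1" by auto
    then show ?thesis by (simp add: eq)
  next
    case 2
    then have "(x mod 10) ^ 20 mod 100 = 76" by auto
    moreover have "2 dvd x mod 10" using 2 by auto
    then have "2 dvd x" by presburger
    then obtain t where "x = 2 * t" by blast
    then have "x ^ 2 = 4 * t ^ 2" by (simp add: power_mult_distrib)
    moreover have "76 * (4 * s) mod 100 = 4 * s mod 100" for s :: nat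
      using mod_mult_self2[of "4 * s" 100 "3 * s"] by simp
    ultimately show ?thesis by (simp only: eq)
  next
    case 3
    then have "(x mod 10) ^ 20 mod 100 = 25" by simp
    moreover have "5 dvd x" using 3 by presburger
    then obtain t where "x = 5 * t" by blast
    then have "x ^ 2 = 25 * t ^ 2" by (simp add: power_mult_distrib)
    moreover have "25 * (25 * s) mod 100 = 25 * s mod 100" for s :: nat
      using mod_mult_self2[of "25 * s" 100 "6 * s"] by simp
    ultimately show ?thesis by (simp only: eq)
  next
    case 4
    then obtain t where "x = 10 * t" by blast
    then have "x ^ 2 = 100 * t ^ 2" by (simp add: power_mult_distrib)
    then show ?thesis using 4 by (simp add: eq)
  qed
qed

text \<open>A factor \<open>x ^ 2\<close> must be available: \<open>2 ^ 21\<close> ends in 52, not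
  in 02.\<close>

lemma power_add_20_mod_100:
  fixes x :: nat
  assumes "e \<ge> 2"
  shows "x ^ (e + 20 * t) mod 100 = x ^ e mod 100"
proof (induction t)
  case (Suc t)
  have "x ^ (e + 20 * Suc t) = x ^ 22 * x ^ (e + 20 * t - 2)"
    using assms by (simp add: algebra_simps flip: power_add)
  moreover have "x ^ (e + 20 * t) = x ^ 2 * x ^ (e + 20 * t - 2)"
    using assms by (metis power_add le_add_diff_inverse trans_le_add1)
  ultimately have "x ^ (e + 20 * Suc t) mod 100 = x ^ (e + 20 * t) mod 100"
    using mod_mult_cong[OF power_22_mod_100[of x] refl, of "x ^ (e + 20 * t - 2)"] by (simp only:)
  with Suc show ?case by simp
qed simp

section \<open>Periodicity of the digits\<close>

text \<open>If 10 does not divide \<open>n\<close>, the base is unchanged modulo 100 and the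
  exponent grows by \<open>5 * 20\<close>. If \<open>n = 10 * m\<close>, the base changes from
  \<open>m\<close> to \<open>m + 10\<close>, but the exponent is a multiple of 10 and tenth powers
  modulo 100 see only the last digit. For multiples of 100 the shift may change the residue of the
  stripped base modulo 10.\<close>

lemma digit_add_100:
  assumes "\<not> 100 dvd n"
  shows "digit (n + 100) = digit n"
proof (cases "10 dvd n")
  case False
  then have "n mod 10 \<noteq> 0" "(n + 100) mod 10 \<noteq> 0" by presburger+
  then have "digit n = n ^ n mod 100 div 10" "digit (n + 100) = (n + 100) ^ (n + 100) mod 100 div 10"
    using digit_eq[of n n 0] digit_eq[of "n + 100" "n + 100" 0] by simp_all
  moreover have "(n + 100) ^ (n + 100) mod 100 = n ^ n mod 100"
  proof -
    have "(n + 100) ^ (n + 100) mod 100 = n ^ (n + 100) mod 100"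
      by (metis power_mod mod_add_self2)
    also have "\<dots> = n ^ n mod 100"
    proof (cases "n \<ge> 2")
      case True
      then show ?thesis using power_add_20_mod_100[of n n 5] by simp
    next
      case False
      moreover have "n \<noteq> 0" using \<open>\<not> 10 dvd n\<close> by (intro notI) simp
      ultimately have "n = 1" by simp
      then show ?thesis by simp
    qed
    finally show ?thesis .
  qed
  ultimately show ?thesis by simp
next
  case True
  then obtain m where n: "n = 10 * m" by blast
  with assms have "m mod 10 \<noteq> 0" by presburger
  then have "(m + 10) mod 10 \<noteq> 0" by presburger
  have "m \<noteq> 0" using \<open>m mod 10 \<noteq> 0\<close> by (intro notI) simp
  have "(m + 10) ^ (n + 100) mod 100 = ((m + 10) ^ 10) ^ (m + 10) mod 100"
    by (simp add: n flip: power_mult)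
  also have "\<dots> = (m ^ 10) ^ (m + 10) mod 100"
    by (metis power_mod add_10_power_10_mod_100)
  also have "\<dots> = m ^ (n + 20 * 5) mod 100" by (simp add: n flip: power_mult)
  also have "\<dots> = m ^ n mod 100" using \<open>m \<noteq> 0\<close> by (intro power_add_20_mod_100) (simp add: n)
  finally show ?thesis
    using digit_eq[OF \<open>m mod 10 \<noteq> 0\<close>, of n 1] digit_eq[OF \<open>(m + 10) mod 10 \<noteq> 0\<close>, of "n + 100" 1]
    by (simp add: n)
qed

definition digit100 :: "nat \<Rightarrow> nat" where "digit100 n = digit (100 * n)"

text \<open>The exponent \<open>100 * n\<close> is a positive multiple of 20, so it can be replaced
  by 20. The digit thus depends only on \<open>m\<close>, not on \<open>k\<close>.\<close>

lemma digit100_eq: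
  assumes m: "m mod 10 \<noteq> 0" and n: "n = 10 ^ k * m"
  shows "digit100 n = m ^ 20 mod 100 div 10"
proof -
  have "m \<noteq> 0" using m by (intro notI) simp
  then have "n > 0" by (simp add: n)
  have "100 * n = 10 ^ (k + 2) * m" by (simp add: n)
  then have "digit100 n = m ^ (100 * n) mod 100 div 10"
    unfolding digit100_def by (rule digit_eq[OF m])
  also have "100 * n = 20 + 20 * (5 * n - 1)" using \<open>n > 0\<close> by simp
  also have "m ^ (20 + 20 * (5 * n - 1)) mod 100 = m ^ 20 mod 100"
    by (rule power_add_20_mod_100) simp
  finally show ?thesis .
qed

text \<open>By convention \<open>0 ^ 0 = 1\<close>, which has a single nonzero digit.\<close>

lemma digit100_0: "digit100 0 = 0"
  using rbln_eq[of 1 0] by (simp add: digit100_def)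

lemma digit100_1: "digit100 1 = 0"
  using digit100_eq[of 1 1 0] by simp

text \<open>\<open>2 ^ 20\<close> ends in 76. This is the first nonzero coefficient of the
  generating function, which therefore vanishes at 0 to order exactly 2.\<close>

lemma digit100_2: "digit100 2 = 7"
  using digit100_eq[of 2 2 0] by simp

lemma digit100_mult_10: "digit100 (10 * n) = digit100 n"
proof (cases "n = 0")
  case False
  have "\<exists>k m. n = 10 ^ k * m \<and> m mod 10 \<noteq> 0" using False
  proof (induction n rule: less_induct)
    case (less n)
    show ?case
    proof (cases "10 dvd n")
      case True
      then obtain n' where n': "n = 10 * n'" by blast
      then obtain k m where "n' = 10 ^ k * m" "m mod 10 \<noteq> 0"
        using less.IH[of n'] less.prems by auto
      then show ?thesis by (intro exI[of _ "Suc k"] exI[of _ m]) (simp add: n')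
    next
      case False
      then show ?thesis by (intro exI[of _ 0] exI[of _ n]) (simp add: dvd_eq_mod_eq_0)
    qed
  qed
  then obtain k m where "n = 10 ^ k * m" "m mod 10 \<noteq> 0" by blast
  then show ?thesis using digit100_eq[of m n k] digit100_eq[of m "10 * n" "Suc k"] by simp
qed simp

lemma digit100_add_10:
  assumes "\<not> 10 dvd n"
  shows "digit100 (n + 10) = digit100 n"
proof -
  have "n mod 10 \<noteq> 0" "(n + 10) mod 10 \<noteq> 0" using assms by presburger+
  moreover have "(n + 10) ^ 20 mod 100 = n ^ 20 mod 100"
    using power_20_mod_100[of n] power_20_mod_100[of "n + 10"] by simp
  ultimately show ?thesis using digit100_eq[of n n 0] digit100_eq[of "n + 10" "n + 10" 0] by simp
qed

section \<open>The generating function of the digits\<close>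

text \<open>Shifting by one period gives
  \<open>y ^ p * T - T = (\<Sum>n<p. u n * y ^ (p - n))\<close>.\<close>

lemma Ints_periodic_series:
  fixes u :: "nat \<Rightarrow> nat" and y :: int
  assumes y: "y > 0" and per: "\<And>n. u (n + p) = u n"
    and T: "(\<lambda>n. real (u n) * (1 / of_int y) ^ n) sums T"
  shows "of_int (y ^ p - 1) * T \<in> \<int>"
proof -
  define z where "z = 1 / real_of_int y"
  have "(\<lambda>n. real (u (n + p)) * z ^ (n + p)) sums (T - (\<Sum>n<p. real (u n) * z ^ n))"
    using T sums_split_initial_segment[of "\<lambda>n. real (u n) * z ^ n" T p] by (simp add: z_def)
  moreover have "(\<lambda>n. real (u (n + p)) * z ^ (n + p)) = (\<lambda>n. z ^ p * (real (u n) * z ^ n))"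
    by (simp add: per power_add mult_ac)
  moreover have "(\<lambda>n. z ^ p * (real (u n) * z ^ n)) sums (z ^ p * T)"
    using T by (intro sums_mult) (simp add: z_def)
  ultimately have eq: "z ^ p * T = T - (\<Sum>n<p. real (u n) * z ^ n)"
    using sums_unique2 by metis
  have "of_int y ^ p * T - of_int y ^ p * z ^ p * T = of_int y ^ p * (\<Sum>n<p. real (u n) * z ^ n)"
    by (simp only: mult.assoc eq right_diff_distrib)
  moreover have "of_int y ^ p * z ^ p = 1" using y by (simp add: z_def flip: power_mult_distrib)
  ultimately have "of_int (y ^ p - 1) * T = of_int y ^ p * (\<Sum>n<p. real (u n) * z ^ n)"
    by (simp add: left_diff_distrib)
  also have "\<dots> = (\<Sum>n<p. of_int y ^ p * (real (u n) * z ^ n))" by (rule sum_distrib_left)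
  also have "\<dots> = (\<Sum>n<p. of_int (y ^ (p - n) * int (u n)))"
  proof (intro sum.cong refl)
    fix n assume "n \<in> {..<p}"
    then have "real_of_int y ^ p = of_int y ^ (p - n) * of_int y ^ n" by (simp flip: power_add)
    then show "of_int y ^ p * (real (u n) * z ^ n) = of_int (y ^ (p - n) * int (u n))"
      using y by (simp add: z_def power_divide)
  qed
  also have "\<dots> \<in> \<int>" by (intro Ints_sum Ints_of_int)
  finally show ?thesis .
qed

text \<open>Serves to leave periodic coefficients: it is applied to \<open>digit100\<close> with
  \<open>p = 10\<close> and to the digits themselves with \<open>p = 100\<close>.\<close>

lemma sums_remove_multiples:
  fixes a :: "nat \<Rightarrow> nat" and z :: real
  assumes "p > 0" and s: "(\<lambda>n. real (a n) * z ^ n) sums s"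
    and t: "(\<lambda>n. real (a (p * n)) * (z ^ p) ^ n) sums t"
  shows "(\<lambda>n. real (if p dvd n then 0 else a n) * z ^ n) sums (s - t)"
proof -
  let ?b = "\<lambda>n. if p dvd n then real (a n) * z ^ n else 0"
  have "(\<lambda>n. ?b (p * n)) sums t" using t by (simp add: power_mult)
  then have "?b sums t"
    using assms(1) by (subst (asm) sums_mono_reindex[of "(*) p" ?b]) (auto simp: strict_mono_def image_def elim!: dvdE)
  from sums_diff[OF s this] show ?thesis
    by (rule back_subst[of "\<lambda>f. f sums (s - t)"]) auto
qed

definition digit_fps :: "real fps" where "digit_fps = Abs_fps (\<lambda>n. real (digit100 n))"

lemma fps_conv_radius_digit_fps: "fps_conv_radius digit_fps \<ge> 1"
  unfolding fps_conv_radius_def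
proof (rule conv_radius_geI_ex')
  fix r :: real assume r: "0 < r" "ereal r < 1"
  show "summable (\<lambda>n. fps_nth digit_fps n * of_real r ^ n)"
  proof (rule summable_comparison_test')
    show "summable (\<lambda>n. 9 * r ^ n)"
      using r by (intro summable_mult summable_geometric) simp
    show "norm (fps_nth digit_fps n * of_real r ^ n) \<le> 9 * r ^ n" for n
    proof -
      have "digit100 n \<le> 9" by (simp add: digit100_def rbln_le_9)
      then have "real (digit100 n) * r ^ n \<le> 9 * r ^ n" using r by (intro mult_right_mono) auto
      then show ?thesis using r by (simp add: digit_fps_def)
    qed
  qed
qed

lemma digit_fps_sums:
  assumes "\<bar>z\<bar> < 1"
  shows "(\<lambda>n. real (digit100 n) * z ^ n) sums eval_fps digit_fps z"
proof -
  have "ereal (norm z) < fps_conv_radius digit_fps"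
    using assms by (intro less_le_trans[OF _ fps_conv_radius_digit_fps]) simp
  then show ?thesis using sums_eval_fps[of z digit_fps] by (simp add: digit_fps_def)
qed

lemma eval_digit_fps_pos:
  assumes "0 < z" "z < 1"
  shows "eval_fps digit_fps z > 0"
proof -
  have "(\<Sum>n\<in>{2}. real (digit100 n) * z ^ n) \<le> eval_fps digit_fps z"
    using assms by (intro sum_le_suminf[THEN order.trans, OF _ _ _ eq_refl] sums_summable[OF digit_fps_sums] sums_unique[symmetric] digit_fps_sums) auto
  then show ?thesis using assms by (simp add: digit100_2) (meson less_le_trans mult_pos_pos zero_less_numeral zero_less_power)
qed

text \<open>Since \<open>digit100 (10 * n) = digit100 n\<close>, the difference is the series over
  the indices not divisible by 10, whose coefficients have period 10.\<close>

lemma digit_fps_functional_Ints: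
  fixes y :: int
  assumes "y \<ge> 2"
  shows "of_int (y ^ 10 - 1) * (eval_fps digit_fps (1 / of_int y) - eval_fps digit_fps (1 / of_int (y ^ 10))) \<in> \<int>"
proof (rule Ints_periodic_series)
  show "y > 0" using assms by simp
  show "(if 10 dvd n + 10 then 0 else digit100 (n + 10)) = (if 10 dvd n then 0 else digit100 n)" for n
    using digit100_add_10[of n] by auto
  have lt: "1 / real_of_int y < 1" using assms by simp
  have eq: "(1 / real_of_int y) ^ 10 = 1 / of_int (y ^ 10)" by (simp add: power_one_over)
  have "(1 / real_of_int y) ^ 10 < 1" using assms by (intro power_Suc_less_one[of _ 9, simplified]) simp_all
  then have "(\<lambda>n. real (digit100 (10 * n)) * ((1 / of_int y) ^ 10) ^ n) sums eval_fps digit_fps (1 / of_int (y ^ 10))"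
    using digit_fps_sums[of "1 / of_int (y ^ 10)"] assms unfolding eq by (simp add: digit100_mult_10)
  then show "(\<lambda>n. real (if 10 dvd n then 0 else digit100 n) * (1 / of_int y) ^ n) sums
      (eval_fps digit_fps (1 / of_int y) - eval_fps digit_fps (1 / of_int (y ^ 10)))"
    using lt assms by (intro sums_remove_multiples digit_fps_sums) auto
qed

section \<open>Values along the orbit of \<open>10^(-100)\<close> under the tenth power map\<close>

definition base_power :: "nat \<Rightarrow> int" where "base_power k = 10 ^ (100 * 10 ^ k)"

lemma base_power_Suc: "base_power (Suc k) = base_power k ^ 10"
proof -
  have "100 * 10 ^ Suc k = (100 * 10 ^ k) * (10::nat)" by simp
  then show ?thesis unfolding base_power_def by (simp only: power_mult)
qed

lemma base_power_ge: "base_power k \<ge> 2"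
proof -
  have "(10::int) ^ 1 \<le> base_power k" unfolding base_power_def by (rule power_increasing) auto
  then show ?thesis by simp
qed

lemma base_power_ge_index: "int k \<le> base_power k"
proof -
  have "k < 10 ^ k" by (rule less_exp[THEN less_le_trans]) (simp add: power_mono)
  also have "(10::nat) ^ k \<le> 100 * 10 ^ k" by simp
  also have "\<dots> < 10 ^ (100 * 10 ^ k)" by (rule less_exp[THEN less_le_trans]) (simp add: power_mono)
  finally have "int k < int (10 ^ (100 * 10 ^ k))" by (simp only: of_nat_less_iff)
  then show ?thesis by (simp add: base_power_def)
qed

lemma filterlim_base_power: "filterlim (\<lambda>k. real_of_int (base_power k)) at_top sequentially"
proof (rule filterlim_at_top_mono[OF filterlim_real_sequentially])
  show "eventually (\<lambda>k. real k \<le> real_of_int (base_power k)) sequentially"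
    using base_power_ge_index by (intro always_eventually allI) (metis of_int_le_iff of_int_of_nat_eq)
qed

text \<open>The contribution of the indices divisible by 100 to the decimal expansion.\<close>

definition digit_value :: real where "digit_value = eval_fps digit_fps (1 / 10 ^ 100)"

text \<open>Telescoping along the functional equation. Since \<open>base_power k - 1\<close> divides
  \<open>base_power (Suc k) - 1\<close>, the denominators do not accumulate and the last one clears
  all of them.\<close>

lemma digit_value_approx: "of_int (base_power k - 1) * (digit_value - eval_fps digit_fps (1 / of_int (base_power k))) \<in> \<int>"
proof (induction k)
  case 0
  show ?case by (simp add: digit_value_def base_power_def)
next
  case (Suc k)
  let ?f = "\<lambda>k. eval_fps digit_fps (1 / of_int (base_power k))"
  obtain w where w: "base_power (Suc k) - 1 = w * (base_power k - 1)"
  proof -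
    have "base_power k - 1 dvd base_power k ^ 10 - 1 ^ 10" by (simp only: power_diff_sumr2 dvd_triv_left)
    then show ?thesis using that unfolding base_power_Suc by (metis dvdE mult.commute power_one)
  qed
  have "of_int (base_power (Suc k) - 1) * (digit_value - ?f (Suc k))
    = of_int w * (of_int (base_power k - 1) * (digit_value - ?f k)) + of_int (base_power (Suc k) - 1) * (?f k - ?f (Suc k))"
    unfolding w by (simp add: algebra_simps)
  also have "\<dots> \<in> \<int>"
    using Ints_add[OF Ints_mult[OF Ints_of_int Suc.IH] digit_fps_functional_Ints[OF base_power_ge[of k]]]
    by (simp only: base_power_Suc)
  finally show ?case .
qed

text \<open>For a value with denominator \<open>b\<close>, the number \<open>b * (Y - 1) * F\<close>
  would be a positive integer, although \<open>F\<close> is at most \<open>C / Y ^ 2\<close> and the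
  product tends to 0.\<close>

lemma digit_value_irrational: "digit_value \<notin> \<rat>"
proof
  assume "digit_value \<in> \<rat>"
  then obtain a b :: int where b: "b > 0" and ab: "digit_value = of_int a / of_int b"
    by (rule Rats_cases')
  let ?z = "\<lambda>k. 1 / real_of_int (base_power k)"
  have "fps_conv_radius digit_fps > 0"
    by (rule less_le_trans[OF _ fps_conv_radius_digit_fps]) simp
  then have "eval_fps digit_fps has_fps_expansion digit_fps" by (rule eval_fps_has_fps_expansion)
  moreover have "fps_nth digit_fps n = 0" if "n < 2" for n
    using that digit100_0 digit100_1 by (auto simp: digit_fps_def less_2_cases_iff)
  ultimately obtain C where "eventually (\<lambda>z. \<bar>eval_fps digit_fps z\<bar> \<le> C * \<bar>z\<bar> ^ 2) (nhds 0)"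
    using has_fps_expansion_bound by blast
  moreover have z0: "?z \<longlonglongrightarrow> 0"
    by (rule tendsto_divide_0[OF tendsto_const filterlim_at_top_imp_at_infinity[OF filterlim_base_power]])
  ultimately have "eventually (\<lambda>k. \<bar>eval_fps digit_fps (?z k)\<bar> \<le> C * \<bar>?z k\<bar> ^ 2) sequentially"
    by (rule eventually_compose_filterlim)
  moreover have "(\<lambda>k. of_int b * C * ?z k) \<longlonglongrightarrow> of_int b * C * 0"
    by (intro tendsto_intros z0)
  then have "eventually (\<lambda>k. of_int b * C * ?z k < 1) sequentially"
    by (intro order_tendstoD) auto
  ultimately have "eventually (\<lambda>k :: nat. False) sequentially"
  proof eventually_elim
    case (elim k)
    define Y where "Y = real_of_int (base_power k)"
    define F where "F = eval_fps digit_fps (1 / Y)"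
    have Y: "Y \<ge> 2" using base_power_ge[of k] by (simp add: Y_def)
    have F: "F > 0" unfolding F_def using Y by (intro eval_digit_fps_pos) auto
    have "of_int b * (of_int (base_power k - 1) * (digit_value - F)) \<in> \<int>"
      unfolding F_def Y_def by (rule Ints_mult[OF Ints_of_int digit_value_approx])
    moreover have "of_int b * (of_int (base_power k - 1) * (digit_value - F)) = of_int ((base_power k - 1) * a) - of_int b * (Y - 1) * F"
      using b by (simp add: ab Y_def field_simps)
    ultimately have "of_int ((base_power k - 1) * a) - (of_int ((base_power k - 1) * a) - of_int b * (Y - 1) * F) \<in> \<int>"
      by (intro Ints_diff Ints_of_int) simp
    then have "of_int b * (Y - 1) * F \<in> \<int>" by simp
    moreover have "of_int b * (Y - 1) * F > 0" using b Y F by simp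
    ultimately have "of_int b * (Y - 1) * F \<ge> 1" by (auto elim!: Ints_cases)
    also have "of_int b * (Y - 1) * F \<le> of_int b * Y * (C * (1 / Y) ^ 2)"
      using elim(1) b Y F by (intro mult_mono) (auto simp: F_def Y_def)
    also have "\<dots> = of_int b * C * (1 / Y)" using Y by (simp add: power2_eq_square)
    finally show False using elim(2) by (simp add: Y_def)
  qed
  then show False by simp
qed

lemma digit_value_transcendental: "\<not> algebraic digit_value"
proof (rule not_algebraic_if_fps_approximable[where f = digit_fps and y = base_power and Q = "\<lambda>k. base_power k - 1"])
  show "fps_conv_radius digit_fps > 0"
    by (rule less_le_trans[OF _ fps_conv_radius_digit_fps]) simp
  show "0 < base_power k - 1" for k using base_power_ge[of k] by simp
  show "fps_nth digit_fps n \<in> \<int>" for n by (simp add: digit_fps_def)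
  show "fps_nth digit_fps 0 = 0" by (simp add: digit_fps_def digit100_0)
  show "of_int (base_power k - 1) * (digit_value - eval_fps digit_fps (1 / of_int (base_power k))) \<in> \<int>" for k
    by (rule digit_value_approx)
qed (simp_all add: filterlim_base_power digit_value_irrational)

section \<open>Return to the decimal constant\<close>

lemma rbln_const_minus_digit_value: "rbln_const - digit_value \<in> \<rat>"
proof -
  define z where "z = 1 / real_of_int 10"
  have z_power: "z ^ n = 1 / 10 ^ n" for n by (simp add: z_def power_one_over)
  \<comment> \<open>Allows the series to start at index 0 without changing its sum.\<close>
  have "digit 0 = 0" using rbln_eq[of 1 0] by simp
  have "(\<lambda>n. real (digit (Suc n)) * z ^ Suc n) sums rbln_const"
    using rbln_const_sums by (simp only: z_power times_divide_eq_right mult_1_right)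
  then have "(\<lambda>n. real (digit n) * z ^ n) sums (rbln_const + real (digit 0) * z ^ 0)"
    by (rule sums_Suc)
  then have "(\<lambda>n. real (digit n) * z ^ n) sums rbln_const"
    by (simp only: \<open>digit 0 = 0\<close> of_nat_0 mult_zero_left add_0_right)
  moreover have "\<bar>z ^ 100\<bar> < 1"
    unfolding z_power by simp
  then have "(\<lambda>n. real (digit (100 * n)) * (z ^ 100) ^ n) sums digit_value"
    using digit_fps_sums[of "z ^ 100"] by (simp only: digit_value_def digit100_def z_power)
  ultimately have "(\<lambda>n. real (if 100 dvd n then 0 else digit n) * z ^ n) sums (rbln_const - digit_value)"
    by (rule sums_remove_multiples[rotated]) simp
  moreover have "(if 100 dvd n + 100 then 0 else digit (n + 100)) = (if 100 dvd n then 0 else digit n)" for n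
    using digit_add_100[of n] by (simp only: dvd_add_triv_right_iff split: if_split) simp
  ultimately have *: "real_of_int (10 ^ 100 - 1) * (rbln_const - digit_value) \<in> \<int>"
    unfolding z_def by (intro Ints_periodic_series) simp_all
  define N where "N = real_of_int (10 ^ 100 - 1)"
  have "N \<noteq> 0" by (simp add: N_def)
  have "N * (rbln_const - digit_value) / N \<in> \<rat>"
    using * Ints_subset_Rats by (intro Rats_divide) (auto simp only: N_def intro: Rats_of_int)
  then show ?thesis using \<open>N \<noteq> 0\<close> by simp
qed

text \<open>Substituting \<open>X + q\<close> into a polynomial vanishing at \<open>x\<close> keeps
  its coefficients rational.\<close>

lemma algebraic_diff_Rats:
  fixes x q :: "'a :: field_char_0"
  assumes "algebraic x" "q \<in> \<rat>"
  shows "algebraic (x - q)"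
proof -
  obtain p where p: "\<And>i. coeff p i \<in> \<rat>" "poly p x = 0" "p \<noteq> 0"
    using assms(1) unfolding algebraic_altdef by blast
  show ?thesis
  proof (rule algebraicI')
    show "coeff (pcompose p [:q, 1:]) i \<in> \<rat>" for i
      using p(1) assms(2) by (intro coeff_pcompose_semiring_closed) (auto simp: coeff_pCons split: nat.splits)
    show "pcompose p [:q, 1:] \<noteq> 0" using p(3) by (simp add: pcompose_eq_0_iff)
    show "poly (pcompose p [:q, 1:]) (x - q) = 0" using p(2) by (simp add: poly_pcompose)
  qed
qed

theorem theorem1p3:
  shows "\<not> algebraic rbln_const"
proof
  assume "algebraic rbln_const"
  from algebraic_diff_Rats[OF this rbln_const_minus_digit_value] have "algebraic digit_value" by simp
  with digit_value_transcendental show False by blast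
qed

end
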